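(* Fix $n$. Let $\mathbf X_1,\dots,\mathbf X_n\in\mathbb R^d$ be fixed covariates, $f_0$ a function, $\boldsymbol\epsilon\sim\mathcal N(\mathbf 0,\boldsymbol\Sigma)$ with $\lambda_{\min}(\boldsymbol\Sigma)\ge\Psi_{low}>0$, and $\mathbf Q$ symmetric positive definite with all eigenvalues of $\mathbf E=(\boldsymbol\Sigma^{1/2})^\top\mathbf Q\boldsymbol\Sigma^{1/2}$ at most $\Lambda_{high}$. For $f\in\mathcal F_n$ define the random variable $X_f=\frac1{\sqrt n}\boldsymbol\epsilon^\top\mathbf Q(\mathbf f-\mathbf f_0)$, where $\mathbf f=(f(\mathbf X_i))_i$, $\mathbf f_0=(f_0(\mathbf X_i))_i$. Then for all $f,g\in\mathcal F_n$, $$\|X_f-X_g\|_{\psi_2}\le C_\Lambda\|f-g\|_n,\qquad C_\Lambda=2(\sqrt2+1)^{1/2}\frac{\Lambda_{high}}{\sqrt{\Psi_{low}}}.$$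
   Context: $\|f\|_n^2=\frac1n\sum_if(\mathbf X_i)^2$; $\boldsymbol\Sigma^{1/2}(\boldsymbol\Sigma^{1/2})^\top=\boldsymbol\Sigma$. Orlicz norm: for $\psi_2(x)=e^{x^2}-1$, $\|X\|_{\psi_2}=\inf\{C>0:\mathbb E\,\psi_2(|X|/C)\le1\}$. $\mathcal F_n$ is the class $\{\alpha_0+\sum_{j=1}^{r_n}\alpha_j\sigma(\boldsymbol\gamma_j^\top\mathbf x+\gamma_{0,j}):\sum_{j=0}^{r_n}|\alpha_j|\le V_n,\ \max_j\sum_{i=0}^d|\gamma_{i,j}|\le M_n\}$ for a bounded Lipschitz activation $\sigma$ (any real-valued functions would do for the statement). *)

theory Defs
  imports "HOL-Probability.Probability"
begin

text \<open>Real eigenvalue of a square matrix.\<close>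
definition eigenvalue_of :: "real^'n^'n \<Rightarrow> real \<Rightarrow> bool" where
  "eigenvalue_of A lam \<longleftrightarrow> (\<exists>v. v \<noteq> 0 \<and> A *v v = lam *\<^sub>R v)"

definition symmetric_mat :: "real^'n^'n \<Rightarrow> bool" where
  "symmetric_mat A \<longleftrightarrow> transpose A = A"

definition pos_def_mat :: "real^'n^'n \<Rightarrow> bool" where
  "pos_def_mat A \<longleftrightarrow> (\<forall>x. x \<noteq> 0 \<longrightarrow> x \<bullet> (A *v x) > 0)"

text \<open>A random vector with law N(0, Sig): every non-trivial linear combination
  is a centred normal with variance a^T Sig a.\<close>
definition centered_gaussian_vector ::
  "'a measure \<Rightarrow> ('a \<Rightarrow> real^'n) \<Rightarrow> real^'n^'n \<Rightarrow> bool" where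
  "centered_gaussian_vector M eps Sig \<longleftrightarrow>
     eps \<in> borel_measurable M \<and>
     (\<forall>a. a \<noteq> 0 \<longrightarrow>
        distributed M lborel (\<lambda>w. a \<bullet> eps w) (normal_density 0 (sqrt (a \<bullet> (Sig *v a)))))"

definition psi2 :: "real \<Rightarrow> real" where
  "psi2 x = exp (x\<^sup>2) - 1"

text \<open>Orlicz psi_2 norm.\<close>
definition psi2_norm :: "'a measure \<Rightarrow> ('a \<Rightarrow> real) \<Rightarrow> real" where
  "psi2_norm M X = Inf {C. C > 0 \<and> (\<integral>\<^sup>+ w. ennreal (psi2 (\<bar>X w\<bar> / C)) \<partial>M) \<le> 1}"

text \<open>Empirical norm over the covariates X_1..X_n (indexed by the finite type 'n).\<close>
definition emp_norm :: "('n::finite \<Rightarrow> real^'d) \<Rightarrow> (real^'d \<Rightarrow> real) \<Rightarrow> real" where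
  "emp_norm Xs f = sqrt ((1 / real CARD('n)) * (\<Sum>i\<in>UNIV. (f (Xs i))\<^sup>2))"

definition eval_vec :: "('n::finite \<Rightarrow> real^'d) \<Rightarrow> (real^'d \<Rightarrow> real) \<Rightarrow> real^'n" where
  "eval_vec Xs f = (\<chi> i. f (Xs i))"

text \<open>The class F_n of one-hidden-layer networks; gamma j is the weight vector and
  gamma0 j the bias of hidden unit j (j = 1..r).\<close>
definition nn_class :: "(real \<Rightarrow> real) \<Rightarrow> nat \<Rightarrow> real \<Rightarrow> real \<Rightarrow> (real^'d \<Rightarrow> real) set" where
  "nn_class \<sigma> r V Mb =
    {(\<lambda>x. \<alpha> 0 + (\<Sum>j=1..r. \<alpha> j * \<sigma> (\<gamma> j \<bullet> x + \<gamma>0 j))) | \<alpha> \<gamma> \<gamma>0.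
       (\<Sum>j=0..r. \<bar>\<alpha> j\<bar>) \<le> V \<and>
       (\<forall>j\<in>{1..r}. \<bar>\<gamma>0 j\<bar> + (\<Sum>i\<in>UNIV. \<bar>\<gamma> j $ i\<bar>) \<le> Mb)}"

text \<open>The process X_f = n^{-1/2} eps^T Q (f - f0).\<close>
definition proc :: "('n::finite \<Rightarrow> real^'d) \<Rightarrow> real^'n^'n \<Rightarrow> (real^'d \<Rightarrow> real)
     \<Rightarrow> ('a \<Rightarrow> real^'n) \<Rightarrow> (real^'d \<Rightarrow> real) \<Rightarrow> 'a \<Rightarrow> real" where
  "proc Xs Q f0 eps f w =
     (1 / sqrt (real CARD('n))) * (eps w \<bullet> (Q *v (eval_vec Xs f - eval_vec Xs f0)))"

end

theory Submission
  imports Defs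
begin

text \<open>X_f - X_g is the linear form a^T eps with a = n^(-1/2) Q h, h = f - g at the covariates,
  so it is centred normal with variance a^T Sig a. For Y ~ N(0, s^2) the expectation of
  exp (Y^2 / C^2) is C / sqrt (C^2 - 2 s^2), which equals 2 at C = sqrt (8/3) s; this bounds the
  psi_2 norm. Writing h = Sroot z, the variance is |E z|^2 / n with E = Sroot^T Q Sroot, so it is
  at most Lambda_high^2 |z|^2 / n, while Psi_low |z|^2 <= |Sroot z|^2 = |h|^2 because Sroot^T Sroot
  has the same eigenvalues as Sig = Sroot Sroot^T. The constant of the statement exceeds sqrt (8/3).\<close>

lemma inner_transpose_mult_vector: "x \<bullet> (transpose A *v y) = (A *v x) \<bullet> (y::real^'n)"
  by (metis dot_lmul_matrix transpose_matrix_vector transpose_transpose inner_commute)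

lemma symmetric_mat_inner: "symmetric_mat A \<Longrightarrow> x \<bullet> (A *v y) = (A *v x) \<bullet> y"
  unfolding symmetric_mat_def by (metis inner_transpose_mult_vector)

lemma symmetric_mat_uminus: "symmetric_mat A \<Longrightarrow> symmetric_mat (- A)"
  unfolding symmetric_mat_def by (simp add: transpose_def vec_eq_iff)

lemma uminus_matrix_vector_mult: "(- A) *v x = - (A *v (x::real^'n))"
  by (simp add: matrix_vector_mult_def vec_eq_iff sum_negf)

lemma symmetric_mat_congruence:
  fixes S Q :: "real^'n^'n"
  assumes "symmetric_mat Q"
  shows "symmetric_mat (transpose S ** Q ** S)"
  using assms unfolding symmetric_mat_def by (simp add: matrix_transpose_mul matrix_mul_assoc)

lemma quadratic_form_congruence:
  fixes S Q :: "real^'n^'n"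
  shows "x \<bullet> ((transpose S ** Q ** S) *v x) = (S *v x) \<bullet> (Q *v (S *v x))"
  unfolding matrix_vector_mul_assoc[symmetric] by (rule inner_transpose_mult_vector)

lemma psd_quadratic_form_Cauchy_Schwarz:
  fixes E :: "real^'n^'n"
  assumes sym: "symmetric_mat E" and psd: "\<And>x. 0 \<le> x \<bullet> (E *v x)"
  shows "(x \<bullet> (E *v y))\<^sup>2 \<le> (x \<bullet> (E *v x)) * (y \<bullet> (E *v y))"
proof -
  define p m q where "p = x \<bullet> (E *v x)" and "m = x \<bullet> (E *v y)" and "q = y \<bullet> (E *v y)"
  have along_line: "0 \<le> p + 2 * t * m + t\<^sup>2 * q" for t
  proof -
    have "0 \<le> (x + t *\<^sub>R y) \<bullet> (E *v (x + t *\<^sub>R y))" by (rule psd)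
    also have "\<dots> = p + t * m + t * (y \<bullet> (E *v x)) + t\<^sup>2 * q"
      by (simp add: matrix_vector_right_distrib matrix_vector_mult_scaleR inner_add_left
          inner_add_right p_def m_def q_def power2_eq_square algebra_simps)
    also have "y \<bullet> (E *v x) = m"
      unfolding m_def using symmetric_mat_inner[OF sym, of y x] by (simp add: inner_commute)
    finally show ?thesis by (simp add: algebra_simps)
  qed
  have "0 \<le> p" "0 \<le> q" using psd by (auto simp: p_def q_def)
  show ?thesis
  proof (cases "q = 0")
    case True
    have "m = 0"
    proof (rule ccontr)
      assume "m \<noteq> 0"
      have "0 \<le> p + 2 * (- (p + 1) / (2 * m)) * m" using along_line[of "- (p + 1) / (2 * m)"] True by simp
      also have "\<dots> = -1" using \<open>m \<noteq> 0\<close> by (simp add: field_simps)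
      finally show False by simp
    qed
    then show ?thesis using \<open>0 \<le> p\<close> True by (simp add: m_def p_def q_def)
  next
    case False
    with \<open>0 \<le> q\<close> have "q > 0" by simp
    have "0 \<le> p + 2 * (- m / q) * m + (- m / q)\<^sup>2 * q" by (rule along_line)
    also have "\<dots> = p - m\<^sup>2 / q"
      using \<open>q > 0\<close> by (simp add: field_simps power2_eq_square)
    finally have "m\<^sup>2 \<le> p * q" using \<open>q > 0\<close> by (simp add: divide_le_eq)
    then show ?thesis by (simp add: m_def p_def q_def)
  qed
qed

lemma quadratic_form_attains_max_on_sphere:
  fixes A :: "real^'n^'n"
  obtains v where "norm v = 1" and "\<And>x. x \<bullet> (A *v x) \<le> (v \<bullet> (A *v v)) * (x \<bullet> x)"
proof -
  let ?q = "\<lambda>x. x \<bullet> (A *v x)"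
  have "continuous_on (sphere 0 1) ?q" by (intro continuous_intros)
  moreover have "sphere (0::real^'n) 1 \<noteq> {}" by simp
  ultimately obtain v where v: "v \<in> sphere 0 1"
    and max: "\<And>y. y \<in> sphere 0 1 \<Longrightarrow> ?q y \<le> ?q v"
    using continuous_attains_sup[OF compact_sphere] by blast
  have "?q x \<le> ?q v * (x \<bullet> x)" for x
  proof (cases "x = 0")
    case False
    have "(1 / norm x) *\<^sub>R x \<in> sphere 0 1" using False by simp
    have "?q x / (norm x)\<^sup>2 = ?q ((1 / norm x) *\<^sub>R x)"
      by (simp add: matrix_vector_mult_scaleR power2_eq_square)
    also have "\<dots> \<le> ?q v" by (rule max) fact
    finally have "?q x / (norm x)\<^sup>2 \<le> ?q v" .
    then show ?thesis using False by (simp add: pos_divide_le_eq dot_square_norm)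
  qed simp
  with v that show ?thesis by simp
qed

text \<open>For the maximiser v of the Rayleigh quotient with value l, the matrix l I - A is positive
  semidefinite and its quadratic form vanishes at v; by Cauchy--Schwarz it then annihilates v.\<close>
lemma symmetric_mat_max_eigenvalue:
  fixes A :: "real^'n^'n"
  assumes sym: "symmetric_mat A"
  obtains l where "eigenvalue_of A l" and "\<And>x. x \<bullet> (A *v x) \<le> l * (x \<bullet> x)"
proof -
  obtain v where v: "norm v = 1"
    and bound: "\<And>x. x \<bullet> (A *v x) \<le> (v \<bullet> (A *v v)) * (x \<bullet> x)"
    using quadratic_form_attains_max_on_sphere[of A] by blast
  define l where "l = v \<bullet> (A *v v)"
  define B where "B = l *\<^sub>R mat 1 - A"
  have B_apply: "B *v x = l *\<^sub>R x - A *v x" for x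
    by (simp add: B_def matrix_vector_mult_diff_rdistrib scaleR_matrix_vector_assoc[symmetric])
  have B_sym: "symmetric_mat B"
    using sym unfolding symmetric_mat_def B_def by (simp add: transpose_def vec_eq_iff mat_def)
  have B_psd: "0 \<le> x \<bullet> (B *v x)" for x
    using bound[of x] by (simp add: B_apply inner_diff_right l_def)
  have "v \<bullet> (B *v v) = 0"
    using v by (simp add: B_apply inner_diff_right l_def dot_square_norm)
  then have "((B *v v) \<bullet> (B *v v))\<^sup>2 \<le> 0"
    using psd_quadratic_form_Cauchy_Schwarz[OF B_sym B_psd, of "B *v v" v] by simp
  then have "B *v v = 0" by simp
  then have "A *v v = l *\<^sub>R v" by (simp add: B_apply)
  moreover have "v \<noteq> 0" using v by auto
  ultimately have "eigenvalue_of A l" unfolding eigenvalue_of_def by blast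
  with that bound show ?thesis unfolding l_def by blast
qed

lemma quadratic_form_le_max_eigenvalue:
  fixes A :: "real^'n^'n"
  assumes "symmetric_mat A" and "\<And>lam. eigenvalue_of A lam \<Longrightarrow> lam \<le> L"
  shows "x \<bullet> (A *v x) \<le> L * (x \<bullet> x)"
proof -
  obtain l where "eigenvalue_of A l" and bound: "x \<bullet> (A *v x) \<le> l * (x \<bullet> x)"
    using symmetric_mat_max_eigenvalue[OF assms(1)] by blast
  then have "l \<le> L" using assms(2) by blast
  then have "l * (x \<bullet> x) \<le> L * (x \<bullet> x)" by (simp add: mult_right_mono)
  with bound show ?thesis by linarith
qed

lemma quadratic_form_ge_min_eigenvalue:
  fixes A :: "real^'n^'n"
  assumes "symmetric_mat A" and "\<And>lam. eigenvalue_of A lam \<Longrightarrow> P \<le> lam"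
  shows "P * (x \<bullet> x) \<le> x \<bullet> (A *v x)"
proof -
  have "eigenvalue_of A (- lam)" if "eigenvalue_of (- A) lam" for lam
    using that unfolding eigenvalue_of_def
    by (metis uminus_matrix_vector_mult minus_equation_iff scaleR_minus_left)
  then have "x \<bullet> ((- A) *v x) \<le> (- P) * (x \<bullet> x)"
    using assms by (intro quadratic_form_le_max_eigenvalue symmetric_mat_uminus) force+
  then show ?thesis by (simp add: uminus_matrix_vector_mult)
qed

lemma pos_def_mat_nonneg: "pos_def_mat A \<Longrightarrow> 0 \<le> x \<bullet> (A *v x)"
  unfolding pos_def_mat_def by (cases "x = 0") (auto intro: less_imp_le)

lemma pos_def_mat_if_eigenvalues_ge:
  fixes A :: "real^'n^'n"
  assumes "symmetric_mat A" and "P > 0" and "\<And>lam. eigenvalue_of A lam \<Longrightarrow> P \<le> lam"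
  shows "pos_def_mat A"
  unfolding pos_def_mat_def
  using quadratic_form_ge_min_eigenvalue[OF assms(1,3)] assms(2)
  by (metis inner_gt_zero_iff mult_pos_pos order_less_le_trans)

lemma psd_mult_vector_norm_bound:
  fixes E :: "real^'n^'n"
  assumes sym: "symmetric_mat E" and psd: "\<And>x. 0 \<le> x \<bullet> (E *v x)"
    and upper: "\<And>x. x \<bullet> (E *v x) \<le> L * (x \<bullet> x)"
  shows "(E *v z) \<bullet> (E *v z) \<le> L\<^sup>2 * (z \<bullet> z)"
proof -
  define u where "u = E *v z"
  have "(u \<bullet> u)\<^sup>2 \<le> (u \<bullet> (E *v u)) * (z \<bullet> (E *v z))"
    unfolding u_def by (rule psd_quadratic_form_Cauchy_Schwarz[OF sym psd])
  also have "\<dots> \<le> (L * (u \<bullet> u)) * (L * (z \<bullet> z))"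
    using psd[of u] upper[of u] psd[of z] upper[of z] by (intro mult_mono) auto
  finally have "(u \<bullet> u) * (u \<bullet> u) \<le> (u \<bullet> u) * (L\<^sup>2 * (z \<bullet> z))"
    by (simp add: power2_eq_square algebra_simps)
  then have "u \<bullet> u \<le> L\<^sup>2 * (z \<bullet> z)"
    by (cases "u \<bullet> u = 0") (simp_all add: zero_le_power2)
  then show ?thesis by (simp add: u_def)
qed

lemma invertible_if_gram_eigenvalues_ge:
  fixes S Sig :: "real^'n^'n"
  assumes gram: "S ** transpose S = Sig"
    and "P > 0" and "\<And>lam. eigenvalue_of Sig lam \<Longrightarrow> P \<le> lam"
  shows "invertible S"
proof -
  have "\<not> eigenvalue_of Sig 0" using assms(2,3) by force
  then have "\<forall>x. Sig *v x = 0 \<longrightarrow> x = 0" unfolding eigenvalue_of_def by auto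
  then obtain B where "B ** Sig = mat 1" using matrix_left_invertible_ker by blast
  then have "S ** (transpose S ** B) = mat 1"
    using gram by (simp add: matrix_left_right_inverse matrix_mul_assoc)
  then show ?thesis using invertible_right_inverse by blast
qed

lemma gram_quadratic_form_lower_bound:
  fixes S Sig :: "real^'n^'n"
  assumes gram: "S ** transpose S = Sig"
    and "P > 0" and eig: "\<And>lam. eigenvalue_of Sig lam \<Longrightarrow> P \<le> lam"
  shows "P * (z \<bullet> z) \<le> (S *v z) \<bullet> (S *v z)"
proof -
  have "invertible S" by (rule invertible_if_gram_eigenvalues_ge[OF assms])
  then have "inj ((*v) S)" by (simp add: invertible_left_inverse matrix_left_invertible_injective)
  have "eigenvalue_of Sig mu" if eig_STS: "eigenvalue_of (transpose S ** S) mu" for mu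
  proof -
    obtain v where v: "v \<noteq> 0" "(transpose S ** S) *v v = mu *\<^sub>R v"
      using eig_STS unfolding eigenvalue_of_def by blast
    have "Sig *v (S *v v) = S *v ((transpose S ** S) *v v)"
      using gram by (simp add: matrix_vector_mul_assoc matrix_mul_assoc)
    also have "\<dots> = mu *\<^sub>R (S *v v)" by (simp add: v(2) matrix_vector_mult_scaleR)
    finally show ?thesis
      unfolding eigenvalue_of_def using \<open>inj ((*v) S)\<close> v(1)
      by (metis matrix_vector_mult_0_right injD)
  qed
  then have "P * (z \<bullet> z) \<le> z \<bullet> ((transpose S ** S) *v z)"
    using eig by (intro quadratic_form_ge_min_eigenvalue)
      (auto simp: symmetric_mat_def matrix_transpose_mul)
  also have "\<dots> = (S *v z) \<bullet> (S *v z)"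
    unfolding matrix_vector_mul_assoc[symmetric] by (rule inner_transpose_mult_vector)
  finally show ?thesis .
qed

lemma eigenvalue_bound_nonneg_if_psd:
  fixes A :: "real^'n^'n"
  assumes "symmetric_mat A" and psd: "\<And>x. 0 \<le> x \<bullet> (A *v x)"
    and "\<And>lam. eigenvalue_of A lam \<Longrightarrow> lam \<le> L"
  shows "0 \<le> L"
proof -
  obtain l where "eigenvalue_of A l" using symmetric_mat_max_eigenvalue[OF assms(1)] by blast
  then obtain v where "v \<noteq> 0" and "A *v v = l *\<^sub>R v" unfolding eigenvalue_of_def by blast
  then have "0 \<le> l * (v \<bullet> v)" using psd[of v] by simp
  moreover have "0 < v \<bullet> v" using \<open>v \<noteq> 0\<close> by simp
  ultimately have "0 \<le> l" by (simp add: zero_le_mult_iff)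
  also have "l \<le> L" using assms(3) \<open>eigenvalue_of A l\<close> .
  finally show ?thesis .
qed

lemma sqrt_quadratic_form_QSigQ_le:
  fixes S Sig Q :: "real^'n^'n"
  assumes gram: "S ** transpose S = Sig"
    and P: "P > 0" and eig_Sig: "\<And>lam. eigenvalue_of Sig lam \<Longrightarrow> P \<le> lam"
    and Q_sym: "symmetric_mat Q" and Q_psd: "\<And>x. 0 \<le> x \<bullet> (Q *v x)"
    and eig_E: "\<And>lam. eigenvalue_of (transpose S ** Q ** S) lam \<Longrightarrow> lam \<le> L"
  shows "sqrt ((Q *v h) \<bullet> (Sig *v (Q *v h))) \<le> L / sqrt P * norm h"
proof -
  define E where "E = transpose S ** Q ** S"
  have E_sym: "symmetric_mat E" unfolding E_def using Q_sym by (rule symmetric_mat_congruence)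
  have E_psd: "0 \<le> x \<bullet> (E *v x)" for x
    unfolding E_def quadratic_form_congruence by (rule Q_psd)
  have "0 \<le> L" using E_sym E_psd eig_E[folded E_def] by (rule eigenvalue_bound_nonneg_if_psd)
  have "invertible S" by (rule invertible_if_gram_eigenvalues_ge[OF gram P eig_Sig])
  then have "surj ((*v) S)"
    by (simp add: invertible_right_inverse matrix_right_invertible_surjective)
  then obtain z where h: "h = S *v z" by (metis surjD)
  have "transpose S *v (Q *v h) = E *v z"
    unfolding E_def h by (simp only: matrix_vector_mul_assoc matrix_mul_assoc)
  moreover have "(Q *v h) \<bullet> (Sig *v (Q *v h))
      = (transpose S *v (Q *v h)) \<bullet> (transpose S *v (Q *v h))"
    using inner_transpose_mult_vector[of "Q *v h" "transpose S"]
    unfolding gram[symmetric] matrix_vector_mul_assoc[symmetric] by (simp only: transpose_transpose)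
  ultimately have "(Q *v h) \<bullet> (Sig *v (Q *v h)) = (E *v z) \<bullet> (E *v z)" by simp
  also have "\<dots> \<le> L\<^sup>2 * (z \<bullet> z)"
    using E_sym E_psd quadratic_form_le_max_eigenvalue[OF E_sym eig_E[folded E_def]]
    by (rule psd_mult_vector_norm_bound)
  also have "\<dots> \<le> L\<^sup>2 * (h \<bullet> h / P)"
    using gram_quadratic_form_lower_bound[OF gram P eig_Sig, of z] P
    unfolding h by (intro mult_left_mono) (simp_all add: pos_le_divide_eq mult.commute)
  also have "\<dots> = (L / sqrt P * norm h)\<^sup>2"
    using P by (simp add: power_mult_distrib power_divide dot_square_norm)
  finally show ?thesis
    using \<open>0 \<le> L\<close> P by (simp add: real_le_lsqrt)
qed

lemma psi2_norm_zero: "psi2_norm M (\<lambda>w. 0) = 0"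
proof -
  have "{C. C > 0 \<and> (\<integral>\<^sup>+ w. ennreal (psi2 (\<bar>0\<bar> / C)) \<partial>M) \<le> 1} = {0<..}"
    by (auto simp: psi2_def)
  then show ?thesis unfolding psi2_norm_def by simp
qed

text \<open>Completing the square in the exponent: 1 / s'^2 = 1 / s^2 - 2 / C^2.\<close>
lemma normal_density_mult_exp_square:
  fixes s C :: real
  assumes s: "s > 0" and C: "C > 0" and sC: "2 * s\<^sup>2 < C\<^sup>2"
  defines "s' \<equiv> s * C / sqrt (C\<^sup>2 - 2 * s\<^sup>2)"
  shows "normal_density 0 s y * exp ((y / C)\<^sup>2)
      = C / sqrt (C\<^sup>2 - 2 * s\<^sup>2) * normal_density 0 s' y"
proof -
  define D where "D = C\<^sup>2 - 2 * s\<^sup>2"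
  have D: "D > 0" using sC by (simp add: D_def)
  have s': "s' > 0" "s'\<^sup>2 = s\<^sup>2 * C\<^sup>2 / D"
    using s C D by (simp_all add: s'_def D_def power_mult_distrib power_divide)
  have "- y\<^sup>2 / (2 * s\<^sup>2) + (y / C)\<^sup>2 = - y\<^sup>2 / (2 * s'\<^sup>2)"
    using s C D unfolding s'(2) D_def by (simp add: field_simps)
  then have "exp (- y\<^sup>2 / (2 * s\<^sup>2)) * exp ((y / C)\<^sup>2) = exp (- y\<^sup>2 / (2 * s'\<^sup>2))"
    by (simp flip: exp_add)
  moreover have "1 / (sqrt (2 * pi) * s) = C / sqrt D * (1 / (sqrt (2 * pi) * s'))"
    using s C D by (simp add: s'_def D_def field_simps)
  ultimately show ?thesis
    using s s'(1) unfolding D_def by (simp add: normal_density_def real_sqrt_mult)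
qed

lemma normal_psi2_nn_integral:
  fixes s C :: real
  assumes distr: "distributed M lborel Y (\<lambda>y. ennreal (normal_density 0 s y))"
    and s: "s > 0" and C: "C > 0" and sC: "2 * s\<^sup>2 < C\<^sup>2"
  shows "(\<integral>\<^sup>+ w. ennreal (psi2 (\<bar>Y w\<bar> / C)) \<partial>M)
      = ennreal (C / sqrt (C\<^sup>2 - 2 * s\<^sup>2) - 1)"
proof -
  define k s' where "k = C / sqrt (C\<^sup>2 - 2 * s\<^sup>2)"
    and "s' = s * C / sqrt (C\<^sup>2 - 2 * s\<^sup>2)"
  have "s' > 0" using s C sC by (simp add: s'_def)
  have integrand:
    "normal_density 0 s y * psi2 (\<bar>y\<bar> / C) = k * normal_density 0 s' y - normal_density 0 s y"
    for y
    using normal_density_mult_exp_square[OF s C sC, of y]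
    unfolding psi2_def k_def s'_def by (simp add: power_divide right_diff_distrib)
  have "(\<integral>\<^sup>+ w. ennreal (psi2 (\<bar>Y w\<bar> / C)) \<partial>M)
      = (\<integral>\<^sup>+ y. ennreal (normal_density 0 s y) * ennreal (psi2 (\<bar>y\<bar> / C)) \<partial>lborel)"
    by (rule distributed_nn_integral[OF distr, symmetric]) (simp add: psi2_def)
  also have "\<dots> = (\<integral>\<^sup>+ y. ennreal (k * normal_density 0 s' y - normal_density 0 s y) \<partial>lborel)"
    by (intro nn_integral_cong) (simp add: integrand[symmetric] ennreal_mult psi2_def)
  also have "\<dots> = ennreal (\<integral> y. (k * normal_density 0 s' y - normal_density 0 s y) \<partial>lborel)"
  proof (rule nn_integral_eq_integral)
    show "integrable lborel (\<lambda>y. k * normal_density 0 s' y - normal_density 0 s y)"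
      using s \<open>s' > 0\<close>
      by (intro Bochner_Integration.integrable_diff integrable_mult_right integrable_normal_density)
    show "AE y in lborel. 0 \<le> k * normal_density 0 s' y - normal_density 0 s y"
      by (intro AE_I2) (simp add: integrand[symmetric] psi2_def)
  qed
  also have "(\<integral> y. (k * normal_density 0 s' y - normal_density 0 s y) \<partial>lborel) = k - 1"
    using s \<open>s' > 0\<close>
    by (subst Bochner_Integration.integral_diff) (auto intro: integrable_mult_right)
  finally show ?thesis unfolding k_def .
qed

lemma psi2_norm_normal_le:
  assumes distr: "distributed M lborel Y (\<lambda>y. ennreal (normal_density 0 s y))" and s: "s > 0"
  shows "psi2_norm M Y \<le> sqrt (8 / 3) * s"
proof -
  define C where "C = sqrt (8 / 3) * s"
  have C: "C > 0" and C2: "C\<^sup>2 = 8 / 3 * s\<^sup>2"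
    using s by (simp_all add: C_def power_mult_distrib)
  then have "C\<^sup>2 - 2 * s\<^sup>2 = (C / 2)\<^sup>2" by (simp add: power_divide)
  then have "C / sqrt (C\<^sup>2 - 2 * s\<^sup>2) = 2" using C by simp
  then have "(\<integral>\<^sup>+ w. ennreal (psi2 (\<bar>Y w\<bar> / C)) \<partial>M) = 1"
    using normal_psi2_nn_integral[OF distr s C] s C2 by simp
  with C show ?thesis
    unfolding psi2_norm_def C_def[symmetric] by (intro cInf_lower bdd_belowI[of _ 0]) auto
qed

lemma psi2_norm_gaussian_linear_form:
  assumes gauss: "centered_gaussian_vector M eps Sig" and "pos_def_mat Sig"
  shows "psi2_norm M (\<lambda>w. a \<bullet> eps w) \<le> sqrt (8 / 3) * sqrt (a \<bullet> (Sig *v a))"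
proof (cases "a = 0")
  case True
  then show ?thesis by (simp add: psi2_norm_zero)
next
  case False
  then have "sqrt (a \<bullet> (Sig *v a)) > 0"
    using assms(2) unfolding pos_def_mat_def by simp
  moreover have "distributed M lborel (\<lambda>w. a \<bullet> eps w)
      (\<lambda>y. ennreal (normal_density 0 (sqrt (a \<bullet> (Sig *v a))) y))"
    using gauss False unfolding centered_gaussian_vector_def by blast
  ultimately show ?thesis by (intro psi2_norm_normal_le)
qed

lemma proc_diff:
  "proc Xs Q f0 eps f w - proc Xs Q f0 eps g w
     = ((1 / sqrt (real CARD('n))) *\<^sub>R (Q *v (eval_vec Xs f - eval_vec Xs g))) \<bullet> eps w"
  for Xs :: "'n::finite \<Rightarrow> real^'d"
  unfolding proc_def
  by (simp add: matrix_vector_mult_diff_distrib inner_diff_right inner_commute algebra_simps)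

lemma emp_norm_diff:
  "emp_norm Xs (\<lambda>x. f x - g x) = norm (eval_vec Xs f - eval_vec Xs g) / sqrt (real CARD('n))"
  for Xs :: "'n::finite \<Rightarrow> real^'d"
  unfolding emp_norm_def norm_eq_sqrt_inner inner_vec_def eval_vec_def
  by (simp add: real_sqrt_divide power2_eq_square)

theorem propositionS1:
  fixes M :: "'a measure"
    and eps :: "'a \<Rightarrow> real^'n::finite"
    and Xs :: "'n \<Rightarrow> real^'d::finite"
    and f0 :: "real^'d \<Rightarrow> real"
    and Sig Sroot Q :: "real^'n^'n"
    and \<sigma> :: "real \<Rightarrow> real"
    and r :: nat and V Mb :: real
    and Psi_low Lambda_high :: real
  assumes "prob_space M"
    and "centered_gaussian_vector M eps Sig"
    and "symmetric_mat Sig"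
    and "Psi_low > 0"
    and "\<And>lam. eigenvalue_of Sig lam \<Longrightarrow> Psi_low \<le> lam"
    and "Sroot ** transpose Sroot = Sig"
    and "symmetric_mat Q" and "pos_def_mat Q"
    and "\<And>lam. eigenvalue_of (transpose Sroot ** Q ** Sroot) lam \<Longrightarrow> lam \<le> Lambda_high"
    and "bounded (range \<sigma>)" and "\<exists>L. L-lipschitz_on UNIV \<sigma>"
    and "f \<in> nn_class \<sigma> r V Mb" and "g \<in> nn_class \<sigma> r V Mb"
  shows "psi2_norm M (\<lambda>w. proc Xs Q f0 eps f w - proc Xs Q f0 eps g w)
           \<le> 2 * sqrt (sqrt 2 + 1) * Lambda_high / sqrt Psi_low * emp_norm Xs (\<lambda>x. f x - g x)"
proof -
  define n where "n = real CARD('n)"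
  define h where "h = eval_vec Xs f - eval_vec Xs g"
  define a where "a = (1 / sqrt n) *\<^sub>R (Q *v h)"
  have Sig_pd: "pos_def_mat Sig" using assms(3-5) by (rule pos_def_mat_if_eigenvalues_ge)
  then have "psi2_norm M (\<lambda>w. a \<bullet> eps w) \<le> sqrt (8 / 3) * sqrt (a \<bullet> (Sig *v a))"
    using assms(2) by (intro psi2_norm_gaussian_linear_form)
  also have "\<dots> \<le> 2 * sqrt (sqrt 2 + 1) * (Lambda_high / sqrt Psi_low * norm h / sqrt n)"
  proof (rule mult_mono)
    have "sqrt (8 / 3) \<le> sqrt (4 * (sqrt 2 + 1))" by (simp add: add_increasing)
    then show "sqrt (8 / 3) \<le> 2 * sqrt (sqrt 2 + 1)" by (simp only: real_sqrt_mult real_sqrt_four)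
    have "sqrt ((Q *v h) \<bullet> (Sig *v (Q *v h))) \<le> Lambda_high / sqrt Psi_low * norm h"
      using assms(4-7,9) pos_def_mat_nonneg[OF assms(8)] by (intro sqrt_quadratic_form_QSigQ_le)
    moreover have "sqrt (a \<bullet> (Sig *v a)) = sqrt ((Q *v h) \<bullet> (Sig *v (Q *v h))) / sqrt n"
      by (simp add: a_def n_def matrix_vector_mult_scaleR real_sqrt_mult real_sqrt_divide)
    ultimately show "sqrt (a \<bullet> (Sig *v a)) \<le> Lambda_high / sqrt Psi_low * norm h / sqrt n"
      by (metis divide_right_mono real_sqrt_ge_zero n_def of_nat_0_le_iff)
  qed (simp_all add: pos_def_mat_nonneg[OF Sig_pd])
  finally show ?thesis
    unfolding a_def h_def n_def proc_diff emp_norm_diff by (simp add: mult.assoc)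
qed

end
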